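(* Let $n\ge 1$, $\alpha=\sqrt{\frac{n+1}{n}}$, $\beta=\frac{1}{n+1}$, and let $\gamma$ be either of the two numbers $\gamma=\frac1n\left(1\pm\frac{1}{\sqrt{n+1}}\right)$. Let $V=\alpha(I-\gamma ee^T)\in\mathbf{R}^{n\times n}$ and $V_+=\begin{bmatrix}V&-Ve\end{bmatrix}\in\mathbf{R}^{n\times(n+1)}$, with columns $v_1,\dots,v_{n+1}$. Let $h>0$, $x_0\in\mathbf{R}^n$, $x_j=x_0+hv_j$ for $j=1,\dots,n+1$, let $f_j=f(x_j)$ for $j=0,1,\dots,n+1$ be the values of a real-valued function $f$, and let $\mathbf{f}=(f_1,\dots,f_n)^T$. Set $$c_1=\frac{1}{h\alpha},\qquad c_2=c_1\left((\gamma n-1)f_{n+1}-\gamma\, e^T\mathbf{f}\right).$$ Then the aligned regular simplex gradient $g$ is given by $$g=c_1\mathbf{f}+c_2e,$$ which is an $\mathcal{O}(n)$ computation (given the function values $f_1,\dots,f_{n+1}$).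
   Context: $e$ denotes the all-ones vector of appropriate size and $I$ the identity matrix. Put $\delta\mathbf{f}_+=(f_1-f_0,\dots,f_{n+1}-f_0)^T\in\mathbf{R}^{n+1}$. The aligned regular simplex gradient (at $x_0$) is the least-squares solution $g\in\mathbf{R}^n$ of the system $(x_j-x_0)^Tg=f_j-f_0$, $j=1,\dots,n+1$, i.e. of $V_+^Tg=\frac1h\delta\mathbf{f}_+$; equivalently, $g$ is the solution of the normal equations $V_+V_+^Tg=\frac1hV_+\delta\mathbf{f}_+$. Computational cost is measured in the number of scalar arithmetic operations, performed after the function values have been evaluated. *)

theory Defs
  imports Complex_Main "HOL-Library.Landau_Symbols" "Jordan_Normal_Form.Matrix"
begin

section \<open>The regular simplex\<close>

definition ones :: "nat \<Rightarrow> real vec" where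
  "ones n = vec n (\<lambda>_. 1)"

definition alpha :: "nat \<Rightarrow> real" where
  "alpha n = sqrt ((real n + 1) / real n)"

text \<open>The sign \<open>s\<close>, which is 1 or -1, selects one of the two admissible values.\<close>

definition gam :: "real \<Rightarrow> nat \<Rightarrow> real" where
  "gam s n = 1 / real n * (1 + s * (1 / sqrt (real n + 1)))"

definition Vmat :: "real \<Rightarrow> nat \<Rightarrow> real mat" where
  "Vmat s n = alpha n \<cdot>\<^sub>m (1\<^sub>m n - gam s n \<cdot>\<^sub>m (mat_of_cols n [ones n] * mat_of_row (ones n)))"

definition Vplus :: "real \<Rightarrow> nat \<Rightarrow> real mat" where
  "Vplus s n = mat_of_cols n (cols (Vmat s n) @ [- (Vmat s n *\<^sub>v ones n)])"

text \<open>Matrix columns and vector entries are indexed from 0, whereas the points \<open>x\<^sub>1, \<dots>, x\<^sub>n\<^sub>+\<^sub>1\<close>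
  are indexed from 1.\<close>

definition simplex_point :: "real \<Rightarrow> nat \<Rightarrow> real \<Rightarrow> real vec \<Rightarrow> nat \<Rightarrow> real vec" where
  "simplex_point s n h x0 j = x0 + h \<cdot>\<^sub>v col (Vplus s n) (j - 1)"

section \<open>The aligned regular simplex gradient\<close>

definition least_squares_solution :: "real mat \<Rightarrow> real vec \<Rightarrow> real vec \<Rightarrow> bool" where
  "least_squares_solution A b g \<longleftrightarrow>
     g \<in> carrier_vec (dim_col A) \<and>
     (\<forall>y \<in> carrier_vec (dim_col A).
        (A *\<^sub>v g - b) \<bullet> (A *\<^sub>v g - b) \<le> (A *\<^sub>v y - b) \<bullet> (A *\<^sub>v y - b))"

text \<open>The system is \<open>(x\<^sub>j - x\<^sub>0)\<^sup>T g = f(x\<^sub>j) - f(x\<^sub>0)\<close> for \<open>j = 1, \<dots>, n + 1\<close>.\<close>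

definition aligned_simplex_gradient ::
  "real \<Rightarrow> nat \<Rightarrow> real \<Rightarrow> real vec \<Rightarrow> (real vec \<Rightarrow> real) \<Rightarrow> real vec \<Rightarrow> bool" where
  "aligned_simplex_gradient s n h x0 f g \<longleftrightarrow>
     least_squares_solution
       (mat_of_rows n (map (\<lambda>j. simplex_point s n h x0 j - x0) [1..<n + 2]))
       (vec (n + 1) (\<lambda>i. f (simplex_point s n h x0 (i + 1)) - f x0))
       g"

section \<open>Computational cost\<close>

text \<open>Straight-line programs over real registers. The first argument of an instruction is the
  register that receives the result. The only literals are natural numbers, so \<open>alpha n\<close> and
  \<open>gam s n\<close> are not available for free; loading a literal is charged as well, so the cost bounds
  the number of arithmetic operations from above.\<close>

datatype instr =
    Lit nat nat
  | Add nat nat nat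
  | Sub nat nat nat
  | Mul nat nat nat
  | Div nat nat nat
  | Sqrt nat nat

type_synonym regs = "nat \<Rightarrow> real"

fun step :: "instr \<Rightarrow> regs \<Rightarrow> regs" where
  "step (Lit d k) m = m(d := real k)"
| "step (Add d a b) m = m(d := m a + m b)"
| "step (Sub d a b) m = m(d := m a - m b)"
| "step (Mul d a b) m = m(d := m a * m b)"
| "step (Div d a b) m = m(d := m a / m b)"
| "step (Sqrt d a) m = m(d := sqrt (m a))"

definition run :: "instr list \<Rightarrow> regs \<Rightarrow> regs" where
  "run p m = fold step p m"

definition cost :: "instr list \<Rightarrow> nat" where
  "cost p = length p"

text \<open>Input: register 0 holds \<open>h\<close>, and register \<open>j\<close> holds the function value \<open>F j\<close> for
  \<open>j = 1, \<dots>, n + 1\<close>. Output: the \<open>j\<close>-th component of the result, counted from 1, is in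
  register \<open>j\<close>.\<close>

definition input_regs :: "nat \<Rightarrow> real \<Rightarrow> (nat \<Rightarrow> real) \<Rightarrow> regs" where
  "input_regs n h F = (\<lambda>r. if r = 0 then h else if r \<le> n + 1 then F r else 0)"

definition output_vec :: "nat \<Rightarrow> regs \<Rightarrow> real vec" where
  "output_vec n m = vec n (\<lambda>i. m (i + 1))"

end

theory Submission
  imports Defs
begin

text \<open>Since \<open>(1 - \<gamma> n)\<^sup>2 = 1 / (n + 1)\<close>, the matrix \<open>V\<^sub>+ V\<^sub>+\<^sup>T\<close> equals \<open>\<alpha>\<^sup>2 I\<close>. The normal equations
  are therefore diagonal, with solution \<open>V\<^sub>+ \<delta>f\<^sub>+ / (h \<alpha>\<^sup>2)\<close>, in which \<open>f\<^sub>0\<close> cancels because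
  the columns of \<open>V\<^sub>+\<close> sum to zero. Evaluating the result takes one pass over the data for
  \<open>e\<^sup>T f\<close>, a constant number of operations for \<open>c\<^sub>1\<close> and \<open>c\<^sub>2\<close>, and two operations per component.\<close>

section \<open>Least squares with orthogonal columns\<close>

lemma scalar_prod_diff_self:
  fixes u v :: "real vec"
  assumes "u \<in> carrier_vec n" "v \<in> carrier_vec n"
  shows "(u - v) \<bullet> (u - v) = u \<bullet> u - 2 * (u \<bullet> v) + v \<bullet> v"
proof -
  have "v \<bullet> u = u \<bullet> v" using assms by (rule comm_scalar_prod[rotated])
  then show ?thesis
    using assms by (simp add: minus_scalar_prod_distrib scalar_prod_minus_distrib)
qed

lemma scalar_prod_self_eq_0_iff:
  fixes v :: "real vec"
  assumes "v \<in> carrier_vec n"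
  shows "v \<bullet> v = 0 \<longleftrightarrow> v = 0\<^sub>v n"
  using assms by (auto simp: scalar_prod_def sum_nonneg_eq_0_iff)

lemma scalar_prod_self_nonneg: "0 \<le> v \<bullet> (v :: real vec)"
  by (simp add: scalar_prod_def sum_nonneg)

text \<open>Complete the square: with \<open>z\<close> the claimed solution, the squared residual at
  \<open>y\<close> is \<open>c\<close> times the squared distance from \<open>y\<close> to
  \<open>z\<close>, plus a term free of \<open>y\<close>. As \<open>c > 0\<close>, the minimiser
  exists and is unique.\<close>

lemma least_squares_orthogonal_columns:
  fixes A :: "real mat"
  assumes A: "A \<in> carrier_mat m n" and b: "b \<in> carrier_vec m"
    and orth: "transpose_mat A * A = c \<cdot>\<^sub>m 1\<^sub>m n" and c: "c > 0"
  shows "least_squares_solution A b g \<longleftrightarrow> g = (1 / c) \<cdot>\<^sub>v (transpose_mat A *\<^sub>v b)"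
proof -
  define z where "z = (1 / c) \<cdot>\<^sub>v (transpose_mat A *\<^sub>v b)"
  have z: "z \<in> carrier_vec n" using A b by (auto simp: z_def)
  have Atb: "transpose_mat A *\<^sub>v b = c \<cdot>\<^sub>v z"
    using c by (simp add: z_def smult_smult_assoc)
  have residual: "(A *\<^sub>v y - b) \<bullet> (A *\<^sub>v y - b) = c * ((y - z) \<bullet> (y - z)) + (b \<bullet> b - c * (z \<bullet> z))"
    if y: "y \<in> carrier_vec n" for y
  proof -
    have "(A *\<^sub>v y) \<bullet> (A *\<^sub>v y) = y \<bullet> (transpose_mat A *\<^sub>v (A *\<^sub>v y))"
      using A y by (metis mult_mat_vec_carrier transpose_carrier_mat transpose_vec_mult_scalar
          comm_scalar_prod)
    also have "transpose_mat A *\<^sub>v (A *\<^sub>v y) = c \<cdot>\<^sub>v y"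
    proof -
      have "transpose_mat A *\<^sub>v (A *\<^sub>v y) = (c \<cdot>\<^sub>m 1\<^sub>m n) *\<^sub>v y"
        unfolding orth[symmetric]
        by (rule assoc_mult_mat_vec[symmetric]) (use A y in auto)
      also have "\<dots> = c \<cdot>\<^sub>v y"
        using y by (intro eq_vecI) auto
      finally show ?thesis .
    qed
    finally have "(A *\<^sub>v y) \<bullet> (A *\<^sub>v y) = c * (y \<bullet> y)" using y by simp
    moreover have "(A *\<^sub>v y) \<bullet> b = c * (y \<bullet> z)"
    proof -
      have "(A *\<^sub>v y) \<bullet> b = (transpose_mat A *\<^sub>v b) \<bullet> y"
        using A b y by (metis mult_mat_vec_carrier transpose_vec_mult_scalar comm_scalar_prod)
      also have "\<dots> = c * (z \<bullet> y)" using y z by (simp add: Atb)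
      finally show ?thesis using comm_scalar_prod[OF y z] by simp
    qed
    ultimately show ?thesis
      unfolding scalar_prod_diff_self[OF y z] scalar_prod_diff_self[OF mult_mat_vec_carrier[OF A y] b]
      by (simp add: algebra_simps)
  qed
  have min: "least_squares_solution A b g \<longleftrightarrow>
      g \<in> carrier_vec n \<and> (\<forall>y \<in> carrier_vec n. (g - z) \<bullet> (g - z) \<le> (y - z) \<bullet> (y - z))"
    using A c residual by (auto simp: least_squares_solution_def)
  have "g = z" if "g \<in> carrier_vec n" "\<forall>y \<in> carrier_vec n. (g - z) \<bullet> (g - z) \<le> (y - z) \<bullet> (y - z)"
  proof -
    \<comment> \<open>Compare \<open>g\<close> with \<open>y = z\<close>, where the right-hand side
      vanishes.\<close>
    have "(g - z) \<bullet> (g - z) \<le> 0" using that z by fastforce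
    then have "g - z = 0\<^sub>v n"
      using scalar_prod_self_nonneg[of "g - z"] scalar_prod_self_eq_0_iff[of "g - z" n] that(1) z
      by fastforce
    then have "(g - z) $ i = 0" if "i < n" for i using that by (simp only: index_zero_vec)
    then show ?thesis using that(1) z by (intro eq_vecI) auto
  qed
  moreover have "(z - z) \<bullet> (z - z) \<le> (y - z) \<bullet> (y - z)" for y
    using z scalar_prod_self_nonneg[of "y - z"] by simp
  ultimately show ?thesis using min z unfolding z_def[symmetric] by blast
qed

section \<open>The gradient of the regular simplex\<close>

text \<open>The coefficients form row \<open>i\<close> of the matrix I - c e e^T, so its product
  with a vector depends only on one entry and the total.\<close>

lemma sum_delta_minus_mult:
  fixes a :: "nat \<Rightarrow> real"
  assumes "i < n"
  shows "(\<Sum>k<n. ((if i = k then 1 else 0) - c) * a k) = a i - c * (\<Sum>k<n. a k)"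
  using assms by (simp add: left_diff_distrib sum_subtractf sum_distrib_left if_distrib[of "\<lambda>x. x * _"]
      cong: if_cong)

lemma alpha_pos: "n \<ge> 1 \<Longrightarrow> alpha n > 0"
  by (simp add: alpha_def)

lemma gam_times: "n \<ge> 1 \<Longrightarrow> gam s n * real n = 1 + s / sqrt (real n + 1)"
  by (simp add: gam_def)

text \<open>The left-hand side is the excess over the identity in every entry of
  \<open>Vplus\<close> times its transpose, up to the factor \<open>(alpha n)\<^sup>2\<close>.
  Multiplied by \<open>n\<close> it becomes (n + 1) (\<gamma> n - 1)^2 - 1, which is 0 for either
  sign \<open>s\<close>.\<close>

lemma gam_quadratic:
  assumes "n \<ge> 1" "s \<in> {1, -1}"
  shows "real n * (gam s n)\<^sup>2 - 2 * gam s n + (gam s n * real n - 1)\<^sup>2 = 0"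
proof -
  let ?t = "gam s n * real n"
  have "(real n + 1) * (?t - 1)\<^sup>2 = 1"
    using assms by (auto simp: gam_times power_divide)
  then have "real n * (real n * (gam s n)\<^sup>2 - 2 * gam s n + (?t - 1)\<^sup>2) = 0"
    by (simp add: algebra_simps power2_eq_square)
  moreover have "real n \<noteq> 0" using assms(1) by simp
  ultimately show ?thesis by (metis mult_eq_0_iff)
qed

lemma Vmat_carrier: "Vmat s n \<in> carrier_mat n n"
  unfolding Vmat_def
  by (intro smult_carrier_mat minus_carrier_mat mult_carrier_mat[where n = 1])
    (auto simp: mat_of_row_def ones_def)

lemma index_Vmat:
  assumes "i < n" "j < n"
  shows "Vmat s n $$ (i, j) = alpha n * ((if i = j then 1 else 0) - gam s n)"
  using assms
  by (simp add: Vmat_def mat_of_row_def mat_of_cols_def ones_def scalar_prod_def)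

lemma Vplus_carrier: "Vplus s n \<in> carrier_mat n (n + 1)"
  using Vmat_carrier[of s n] by (simp add: Vplus_def mat_of_cols_def)

text \<open>Every row of \<open>Vmat\<close> has the same sum, so the last column -Ve is a multiple
  of the all-ones vector.\<close>

lemma index_Vplus:
  assumes "i < n" "j < n + 1"
  shows "Vplus s n $$ (i, j) = alpha n *
    (if j < n then (if i = j then 1 else 0) - gam s n else gam s n * real n - 1)"
proof (cases "j < n")
  case True
  then show ?thesis
    using assms Vmat_carrier[of s n]
    by (simp add: Vplus_def mat_of_cols_def nth_append index_Vmat)
next
  case False
  then have "j = n" using assms by simp
  moreover have "(Vmat s n *\<^sub>v ones n) $ i = alpha n * (1 - gam s n * real n)"
  proof -
    have "(Vmat s n *\<^sub>v ones n) $ i = (\<Sum>k<n. alpha n * ((if i = k then 1 else 0) - gam s n))"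
      using assms Vmat_carrier[of s n]
      by (simp add: scalar_prod_def ones_def index_Vmat atLeast0LessThan)
    also have "\<dots> = alpha n * (1 - gam s n * real n)"
      using sum_delta_minus_mult[OF assms(1), of "gam s n" "\<lambda>_. 1"]
      by (simp flip: sum_distrib_left)
    finally show ?thesis .
  qed
  ultimately show ?thesis
    using assms Vmat_carrier[of s n]
    by (simp add: Vplus_def mat_of_cols_def nth_append algebra_simps)
qed

text \<open>Serves both for the products of two rows of \<open>Vplus\<close> and for
  \<open>Vplus\<close> applied to the function differences; \<open>a n\<close> is the weight of the
  last column.\<close>

lemma sum_row_Vplus:
  assumes "i < n"
  shows "(\<Sum>k<n + 1. Vplus s n $$ (i, k) * a k) =
    alpha n * (a i - gam s n * (\<Sum>k<n. a k) + (gam s n * real n - 1) * a n)"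
proof -
  have "(\<Sum>k<n. Vplus s n $$ (i, k) * a k) =
      alpha n * (\<Sum>k<n. ((if i = k then 1 else 0) - gam s n) * a k)"
    unfolding sum_distrib_left
    by (rule sum.cong) (use assms in \<open>auto simp: index_Vplus\<close>)
  then show ?thesis
    using assms unfolding sum_delta_minus_mult[OF assms]
    by (simp add: index_Vplus distrib_left)
qed

lemma Vplus_mult_transpose:
  assumes "n \<ge> 1" "s \<in> {1, -1}"
  shows "Vplus s n * transpose_mat (Vplus s n) = (alpha n)\<^sup>2 \<cdot>\<^sub>m 1\<^sub>m n"
proof (rule eq_matI)
  fix i j assume "i < dim_row ((alpha n)\<^sup>2 \<cdot>\<^sub>m 1\<^sub>m n :: real mat)"
    "j < dim_col ((alpha n)\<^sup>2 \<cdot>\<^sub>m 1\<^sub>m n :: real mat)"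
  then have ij: "i < n" "j < n" by simp_all
  let ?\<delta> = "if i = j then 1 else 0 :: real"
  \<comment> \<open>Cutting the weights off at \<open>n\<close> removes the last column and leaves
    the row sum of \<open>Vmat\<close>.\<close>
  have sum: "(\<Sum>k<n. Vplus s n $$ (j, k)) = alpha n * (1 - gam s n * real n)"
    using sum_row_Vplus[OF ij(2), of s "\<lambda>k. if k < n then 1 else 0"] ij(2) by auto
  have "(Vplus s n * transpose_mat (Vplus s n)) $$ (i, j) =
      (\<Sum>k<n + 1. Vplus s n $$ (i, k) * Vplus s n $$ (j, k))"
    using ij Vplus_carrier[of s n] by (simp add: scalar_prod_def atLeast0LessThan)
  \<comment> \<open>Here row \<open>j\<close> of \<open>Vplus\<close> is the weight vector; all
    terms besides \<open>?\<delta>\<close> collect into the expression of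
    \<open>gam_quadratic\<close>.\<close>
  also have "\<dots> = (alpha n)\<^sup>2 *
      (?\<delta> + (real n * (gam s n)\<^sup>2 - 2 * gam s n + (gam s n * real n - 1)\<^sup>2))"
    unfolding sum_row_Vplus[OF ij(1)] sum using ij
    by (simp add: index_Vplus algebra_simps power2_eq_square)
  also have "\<dots> = ((alpha n)\<^sup>2 \<cdot>\<^sub>m 1\<^sub>m n) $$ (i, j)"
    using ij assms by (simp add: gam_quadratic)
  finally show "(Vplus s n * transpose_mat (Vplus s n)) $$ (i, j) =
      ((alpha n)\<^sup>2 \<cdot>\<^sub>m 1\<^sub>m n) $$ (i, j)" .
qed (use Vplus_carrier[of s n] in auto)

lemma simplex_rows_eq:
  assumes "x0 \<in> carrier_vec n"
  shows "mat_of_rows n (map (\<lambda>j. simplex_point s n h x0 j - x0) [1..<n + 2]) =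
    h \<cdot>\<^sub>m transpose_mat (Vplus s n)"
proof (rule eq_matI)
  fix i j assume "i < dim_row (h \<cdot>\<^sub>m transpose_mat (Vplus s n))"
    "j < dim_col (h \<cdot>\<^sub>m transpose_mat (Vplus s n))"
  then have ij: "i < n + 1" "j < n" using Vplus_carrier[of s n] by auto
  \<comment> \<open>Row \<open>i\<close> belongs to point \<open>i + 1\<close>, and
    \<open>simplex_point\<close> shifts back by one, so it is column \<open>i\<close> of
    \<open>Vplus\<close>.\<close>
  then have "[1..<n + 2] ! i = i + 1" by (simp del: upt_Suc)
  then show "mat_of_rows n (map (\<lambda>j. simplex_point s n h x0 j - x0) [1..<n + 2]) $$ (i, j) =
      (h \<cdot>\<^sub>m transpose_mat (Vplus s n)) $$ (i, j)"
    using ij assms Vplus_carrier[of s n]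
    by (simp add: mat_of_rows_def simplex_point_def del: upt_Suc)
qed (use Vplus_carrier[of s n] in auto)

text \<open>The system matrix is \<open>h\<close> times the transpose of \<open>Vplus\<close>, so
  its columns are orthogonal with \<open>c\<close> equal to
  \<open>h\<^sup>2 * (alpha n)\<^sup>2\<close>. The right-hand side of the normal equations supplies
  one factor \<open>h * alpha n\<close>, which leaves the reciprocal of
  \<open>h * alpha n\<close>.\<close>

lemma aligned_simplex_gradient_iff:
  fixes F :: "nat \<Rightarrow> real"
  assumes n: "n \<ge> 1" and s: "s \<in> {1, -1}" and h: "h > 0" and x0: "x0 \<in> carrier_vec n"
    and F: "\<And>j. F j = f (simplex_point s n h x0 j)"
  shows "aligned_simplex_gradient s n h x0 f g \<longleftrightarrow>
    g = vec n (\<lambda>i. 1 / (h * alpha n) * (F (i + 1) +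
      ((gam s n * real n - 1) * F (n + 1) - gam s n * (\<Sum>k<n. F (k + 1)))))"
proof -
  let ?A = "h \<cdot>\<^sub>m transpose_mat (Vplus s n)"
  let ?b = "vec (n + 1) (\<lambda>i. F (i + 1) - f x0)"
  have A: "?A \<in> carrier_mat (n + 1) n" using Vplus_carrier[of s n] by simp
  have At: "transpose_mat ?A = h \<cdot>\<^sub>m Vplus s n" by (auto intro!: eq_matI)
  have "transpose_mat ?A * ?A = (h\<^sup>2 * (alpha n)\<^sup>2) \<cdot>\<^sub>m 1\<^sub>m n"
  proof -
    have "transpose_mat ?A * ?A = h \<cdot>\<^sub>m (h \<cdot>\<^sub>m (Vplus s n * transpose_mat (Vplus s n)))"
      unfolding At using Vplus_carrier[of s n]
      by (simp add: mult_smult_assoc_mat[where nr = n and n = "n + 1" and nc = n]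
          mult_smult_distrib[where nr = n and n = "n + 1" and nc = n])
    then show ?thesis
      unfolding Vplus_mult_transpose[OF n s] by (auto intro!: eq_matI simp: power2_eq_square)
  qed
  moreover have "0 < h\<^sup>2 * (alpha n)\<^sup>2" using h alpha_pos[OF n] by simp
  ultimately have "aligned_simplex_gradient s n h x0 f g \<longleftrightarrow>
      g = (1 / (h\<^sup>2 * (alpha n)\<^sup>2)) \<cdot>\<^sub>v (transpose_mat ?A *\<^sub>v ?b)"
    unfolding aligned_simplex_gradient_def simplex_rows_eq[OF x0] F[symmetric]
    by (intro least_squares_orthogonal_columns[OF A]) auto
  also have "(1 / (h\<^sup>2 * (alpha n)\<^sup>2)) \<cdot>\<^sub>v (transpose_mat ?A *\<^sub>v ?b) =
      vec n (\<lambda>i. 1 / (h * alpha n) * (F (i + 1) +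
        ((gam s n * real n - 1) * F (n + 1) - gam s n * (\<Sum>k<n. F (k + 1)))))"
  proof (rule eq_vecI)
    fix i assume "i < dim_vec (vec n (\<lambda>i. 1 / (h * alpha n) * (F (i + 1) +
        ((gam s n * real n - 1) * F (n + 1) - gam s n * (\<Sum>k<n. F (k + 1))))))"
    then have i: "i < n" by simp
    have "(transpose_mat ?A *\<^sub>v ?b) $ i =
        h * (\<Sum>k<n + 1. Vplus s n $$ (i, k) * (F (k + 1) - f x0))"
      unfolding At using i Vplus_carrier[of s n]
      by (simp add: scalar_prod_def atLeast0LessThan sum_distrib_left algebra_simps)
    \<comment> \<open>The value \<open>f x0\<close> enters with coefficient 1 - \<gamma> n +
      (\<gamma> n - 1) = 0.\<close>
    also have "\<dots> = h * alpha n * (F (i + 1) +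
        ((gam s n * real n - 1) * F (n + 1) - gam s n * (\<Sum>k<n. F (k + 1))))"
      unfolding sum_row_Vplus[OF i] by (simp add: sum_subtractf algebra_simps)
    finally show "((1 / (h\<^sup>2 * (alpha n)\<^sup>2)) \<cdot>\<^sub>v (transpose_mat ?A *\<^sub>v ?b)) $ i =
        vec n (\<lambda>i. 1 / (h * alpha n) * (F (i + 1) +
          ((gam s n * real n - 1) * F (n + 1) - gam s n * (\<Sum>k<n. F (k + 1))))) $ i"
      using i h alpha_pos[OF n] Vplus_carrier[of s n] by (simp add: power2_eq_square)
  qed (use Vplus_carrier[of s n] in auto)
  finally show ?thesis .
qed

section \<open>A straight-line program for the gradient\<close>

lemma run_append: "run (p @ q) m = run q (run p m)"
  by (simp add: run_def)

lemma run_Cons: "run (i # p) m = run p (step i m)"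
  by (simp add: run_def)

lemma run_Nil: "run [] m = m"
  by (simp add: run_def)

definition sum_prog :: "nat \<Rightarrow> nat \<Rightarrow> instr list" where
  "sum_prog n d = map (\<lambda>j. Add d d (j + 1)) [0..<n]"

text \<open>The bound on \<open>d\<close> keeps the accumulator away from the registers being
  summed.\<close>

lemma run_sum_prog:
  "n < d \<Longrightarrow> run (sum_prog n d) m = m(d := m d + (\<Sum>k<n. m (k + 1)))"
  by (induction n) (auto simp: sum_prog_def run_append run_Cons run_Nil)

definition affine_prog :: "nat \<Rightarrow> nat \<Rightarrow> nat \<Rightarrow> instr list" where
  "affine_prog n a b = concat (map (\<lambda>j. [Mul (j + 1) a (j + 1), Add (j + 1) (j + 1) b]) [0..<n])"

text \<open>Components are overwritten in place; \<open>a\<close> and \<open>b\<close> lie above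
  \<open>n\<close>, so both coefficients survive the whole pass.\<close>

lemma run_affine_prog:
  "n < a \<Longrightarrow> n < b \<Longrightarrow>
    run (affine_prog n a b) m = (\<lambda>r. if 1 \<le> r \<and> r \<le> n then m a * m r + m b else m r)"
  by (induction n) (auto simp: affine_prog_def run_append run_Cons run_Nil fun_eq_iff le_Suc_eq)

text \<open>Register \<open>n + 2\<close> holds \<open>e\<^sup>T f\<close> on entry; \<open>c\<^sub>1\<close> is left in \<open>n + 6\<close> and \<open>c\<^sub>2\<close> in \<open>n + 7\<close>.\<close>

definition coeff_prog :: "real \<Rightarrow> nat \<Rightarrow> instr list" where
  "coeff_prog s n =
    [Lit (n + 3) 1, Lit (n + 4) n, Add (n + 5) (n + 4) (n + 3),
     Div (n + 6) (n + 5) (n + 4), Sqrt (n + 6) (n + 6), Mul (n + 6) 0 (n + 6),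
     Div (n + 6) (n + 3) (n + 6),
     Sqrt (n + 5) (n + 5), Div (n + 5) (n + 3) (n + 5),
     (if s = 1 then Add (n + 5) (n + 3) (n + 5) else Sub (n + 5) (n + 3) (n + 5)),
     Sub (n + 7) (n + 5) (n + 3), Mul (n + 7) (n + 7) (n + 1),
     Div (n + 8) (n + 5) (n + 4), Mul (n + 8) (n + 8) (n + 2),
     Sub (n + 7) (n + 7) (n + 8), Mul (n + 7) (n + 6) (n + 7)]"

text \<open>Register \<open>n + 5\<close> runs through n + 1, its square root, the reciprocal of
  that, and finally \<gamma> n; dividing by \<open>n\<close> then yields \<gamma> in
  \<open>n + 8\<close>. The last claim preserves the function values for the affine pass.\<close>

lemma run_coeff_prog:
  assumes "n \<ge> 1" "s \<in> {1, -1}"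
  shows "run (coeff_prog s n) m (n + 6) = 1 / (m 0 * alpha n)"
    and "run (coeff_prog s n) m (n + 7) = 1 / (m 0 * alpha n) *
      ((gam s n * real n - 1) * m (n + 1) - gam s n * m (n + 2))"
    and "r \<le> n \<Longrightarrow> run (coeff_prog s n) m r = m r"
proof -
  show "run (coeff_prog s n) m (n + 6) = 1 / (m 0 * alpha n)"
    using assms(2) by (auto simp: coeff_prog_def run_Cons run_Nil alpha_def)
  show "run (coeff_prog s n) m (n + 7) = 1 / (m 0 * alpha n) *
      ((gam s n * real n - 1) * m (n + 1) - gam s n * m (n + 2))"
    unfolding gam_times[OF assms(1)]
    using assms(2) by (auto simp: coeff_prog_def run_Cons run_Nil alpha_def gam_def)
  show "run (coeff_prog s n) m r = m r" if "r \<le> n"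
    using assms(2) that by (auto simp: coeff_prog_def run_Cons run_Nil)
qed

text \<open>The sum and the coefficients come first because the affine pass destroys the function
  values.\<close>

definition gradient_prog :: "real \<Rightarrow> nat \<Rightarrow> instr list" where
  "gradient_prog s n = sum_prog n (n + 2) @ coeff_prog s n @ affine_prog n (n + 6) (n + 7)"

lemma cost_gradient_prog: "cost (gradient_prog s n) = 3 * n + 16"
proof -
  have "length (affine_prog n a b) = 2 * n" for a b
    by (induction n) (auto simp: affine_prog_def)
  then show ?thesis by (simp add: cost_def gradient_prog_def sum_prog_def coeff_prog_def)
qed

lemma output_gradient_prog:
  assumes "n \<ge> 1" "s \<in> {1, -1}"
  shows "output_vec n (run (gradient_prog s n) (input_regs n h F)) =
    vec n (\<lambda>i. 1 / (h * alpha n) * (F (i + 1) +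
      ((gam s n * real n - 1) * F (n + 1) - gam s n * (\<Sum>k<n. F (k + 1)))))"
proof (rule eq_vecI)
  let ?m = "run (sum_prog n (n + 2)) (input_regs n h F)"
  \<comment> \<open>Registers above \<open>n + 1\<close> are initially 0, so the accumulator
    \<open>n + 2\<close> starts from 0.\<close>
  have m: "?m = (input_regs n h F)(n + 2 := \<Sum>k<n. F (k + 1))"
    by (simp add: run_sum_prog input_regs_def)
  fix i assume "i < dim_vec (vec n (\<lambda>i. 1 / (h * alpha n) * (F (i + 1) +
      ((gam s n * real n - 1) * F (n + 1) - gam s n * (\<Sum>k<n. F (k + 1))))))"
  then have i: "i < n" by simp
  then have "output_vec n (run (gradient_prog s n) (input_regs n h F)) $ i =
      run (coeff_prog s n) ?m (n + 6) * run (coeff_prog s n) ?m (i + 1) +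
      run (coeff_prog s n) ?m (n + 7)"
    by (simp add: output_vec_def gradient_prog_def run_append run_affine_prog)
  also have "\<dots> = 1 / (?m 0 * alpha n) * ?m (i + 1) + 1 / (?m 0 * alpha n) *
      ((gam s n * real n - 1) * ?m (n + 1) - gam s n * ?m (n + 2))"
    using i by (simp only: run_coeff_prog[OF assms])
  also have "\<dots> = 1 / (h * alpha n) * (F (i + 1) +
      ((gam s n * real n - 1) * F (n + 1) - gam s n * (\<Sum>k<n. F (k + 1))))"
    using i unfolding m by (simp add: input_regs_def distrib_left)
  finally show "output_vec n (run (gradient_prog s n) (input_regs n h F)) $ i =
      vec n (\<lambda>i. 1 / (h * alpha n) * (F (i + 1) +
        ((gam s n * real n - 1) * F (n + 1) - gam s n * (\<Sum>k<n. F (k + 1))))) $ i"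
    using i by simp
qed (simp add: output_vec_def)

theorem theorem3:
  shows "\<exists>P :: real \<Rightarrow> nat \<Rightarrow> instr list.
    (\<forall>s \<in> {1, -1}. (\<lambda>n. real (cost (P s n))) \<in> O(\<lambda>n. real n)) \<and>
    (\<forall>(n::nat) (s::real) (h::real) (x0::real vec) (f::real vec \<Rightarrow> real).
       n \<ge> 1 \<and> s \<in> {1, -1} \<and> h > 0 \<and> x0 \<in> carrier_vec n \<longrightarrow>
       (let F = (\<lambda>j. f (simplex_point s n h x0 j));
            fvec = vec n (\<lambda>i. F (i + 1));
            c1 = 1 / (h * alpha n);
            c2 = c1 * ((gam s n * real n - 1) * F (n + 1) - gam s n * (ones n \<bullet> fvec))
        in (\<forall>g. aligned_simplex_gradient s n h x0 f g \<longleftrightarrow> g = c1 \<cdot>\<^sub>v fvec + c2 \<cdot>\<^sub>v ones n) \<and>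
           output_vec n (run (P s n) (input_regs n h F)) = c1 \<cdot>\<^sub>v fvec + c2 \<cdot>\<^sub>v ones n))"
proof (rule exI[of _ gradient_prog], intro conjI ballI allI impI)
  fix s :: real
  show "(\<lambda>n. real (cost (gradient_prog s n))) \<in> O(\<lambda>n. real n)"
  \<comment> \<open>For n \<ge> 1 the cost 3 n + 16 is at most (3 + 16) n.\<close>
  proof (rule bigoI[of _ 19])
    show "\<forall>\<^sub>F n in sequentially. norm (real (cost (gradient_prog s n))) \<le> 19 * norm (real n)"
      using eventually_ge_at_top[of 1] by eventually_elim (simp add: cost_gradient_prog)
  qed
next
  fix n :: nat and s h :: real and x0 :: "real vec" and f :: "real vec \<Rightarrow> real"
  assume asm: "n \<ge> 1 \<and> s \<in> {1, -1} \<and> h > 0 \<and> x0 \<in> carrier_vec n"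
  define F where "F = (\<lambda>j. f (simplex_point s n h x0 j))"
  define fvec where "fvec = vec n (\<lambda>i. F (i + 1))"
  define c1 where "c1 = 1 / (h * alpha n)"
  define c2 where "c2 = c1 * ((gam s n * real n - 1) * F (n + 1) - gam s n * (ones n \<bullet> fvec))"
  \<comment> \<open>Both conjuncts are compared with this componentwise form, which the gradient and
    the program output share.\<close>
  have closed_form: "c1 \<cdot>\<^sub>v fvec + c2 \<cdot>\<^sub>v ones n = vec n (\<lambda>i. 1 / (h * alpha n) * (F (i + 1) +
      ((gam s n * real n - 1) * F (n + 1) - gam s n * (\<Sum>k<n. F (k + 1)))))"
    by (rule eq_vecI)
      (simp_all add: fvec_def c1_def c2_def ones_def scalar_prod_def atLeast0LessThan
        distrib_left)
  have "(\<forall>g. aligned_simplex_gradient s n h x0 f g \<longleftrightarrow> g = c1 \<cdot>\<^sub>v fvec + c2 \<cdot>\<^sub>v ones n) \<and>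
      output_vec n (run (gradient_prog s n) (input_regs n h F)) = c1 \<cdot>\<^sub>v fvec + c2 \<cdot>\<^sub>v ones n"
    unfolding closed_form
    using asm aligned_simplex_gradient_iff[of n s h x0 F f] output_gradient_prog[of n s h F]
    by (simp add: F_def)
  then show "let F = (\<lambda>j. f (simplex_point s n h x0 j));
            fvec = vec n (\<lambda>i. F (i + 1));
            c1 = 1 / (h * alpha n);
            c2 = c1 * ((gam s n * real n - 1) * F (n + 1) - gam s n * (ones n \<bullet> fvec))
        in (\<forall>g. aligned_simplex_gradient s n h x0 f g \<longleftrightarrow> g = c1 \<cdot>\<^sub>v fvec + c2 \<cdot>\<^sub>v ones n) \<and>
           output_vec n (run (gradient_prog s n) (input_regs n h F)) = c1 \<cdot>\<^sub>v fvec + c2 \<cdot>\<^sub>v ones n"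
    unfolding Let_def c2_def c1_def fvec_def F_def .
qed

end
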